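(* Let $t>0$, let $i_1<\dots<i_M$ be real, let $\underline b=(b_2,\dots,b_{M-1})$ satisfy $-\frac{1}{i_{j+1}-i_j}<b_j<\frac{1}{i_j-i_{j-1}}$ for $j=2,\dots,M-1$, and let $\underline k\in\mathbb R_+^{M-2}$. For every integer $p\ge1$ there exists a constant $c>0$, independent of $\underline\lambda\in\mathbb R_+^{M-2}$, such that for all $\underline\lambda\in\mathbb R_+^{M-2}$ and all $j\in\{1,\dots,M\}$, $$\big(\widetilde{\mathcal N}_t(\underline k,\underline\lambda)^{-p}\big)_{j,M+1}<1-c .$$
   Context: Conventions: $\mathbb R_+=[0,\infty)$, $M\ge3$, $\underline\lambda=(\lambda_2,\dots,\lambda_{M-1})$. Set $\widetilde k_j=(i_{j+1}-i_j)(i_j-i_{j-1})k_j$ for $2\le j\le M-1$; for $2\le j\le M-1$, $q_{j,j+1}=\frac{i_j-i_{j-1}}{i_{j+1}-i_{j-1}}(1+(i_{j+1}-i_j)b_j)$, $q_{j,j-1}=\frac{i_{j+1}-i_j}{i_{j+1}-i_{j-1}}(1-(i_j-i_{j-1})b_j)$. $\widetilde{\mathcal N}_t=\widetilde{\mathcal N}_t(\underline k,\underline\lambda)$ is the $(M+1)\times(M+1)$ matrix whose rows $1$, $M$, $M+1$ are those of the identity matrix and, for $2\le j\le M-1$, $\widetilde{\mathcal N}_{t;j,j}=1+t\lambda_j(1+\widetilde k_j)$, $\widetilde{\mathcal N}_{t;j,j+1}=-t\lambda_jq_{j,j+1}$, $\widetilde{\mathcal N}_{t;j,j-1}=-t\lambda_jq_{j,j-1}$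 (neighbours in $\{1,\dots,M\}$), $\widetilde{\mathcal N}_{t;j,M+1}=-t\lambda_j\widetilde k_j$, all other entries $0$. *)

theory Defs
  imports "Jordan_Normal_Form.Gauss_Jordan_Elimination"
begin

text \<open>
  The tuples \<open>(i\<^sub>1,\<dots>,i\<^sub>M)\<close> and \<open>(b\<^sub>2,\<dots>,b\<^sub>M\<^sub>-\<^sub>1)\<close>, \<open>(k\<^sub>2,\<dots>,k\<^sub>M\<^sub>-\<^sub>1)\<close>,
  \<open>(\<lambda>\<^sub>2,\<dots>,\<lambda>\<^sub>M\<^sub>-\<^sub>1)\<close> are functions on \<open>nat\<close>; values outside the stated index ranges
  do not enter the matrix.
\<close>

definition ktilde :: "(nat \<Rightarrow> real) \<Rightarrow> (nat \<Rightarrow> real) \<Rightarrow> nat \<Rightarrow> real" where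
  "ktilde i k j = (i (j + 1) - i j) * (i j - i (j - 1)) * k j"

definition q_up :: "(nat \<Rightarrow> real) \<Rightarrow> (nat \<Rightarrow> real) \<Rightarrow> nat \<Rightarrow> real" where
  "q_up i b j = (i j - i (j - 1)) / (i (j + 1) - i (j - 1)) * (1 + (i (j + 1) - i j) * b j)"

definition q_down :: "(nat \<Rightarrow> real) \<Rightarrow> (nat \<Rightarrow> real) \<Rightarrow> nat \<Rightarrow> real" where
  "q_down i b j = (i (j + 1) - i j) / (i (j + 1) - i (j - 1)) * (1 - (i j - i (j - 1)) * b j)"

definition Ntilde_entry ::
  "nat \<Rightarrow> (nat \<Rightarrow> real) \<Rightarrow> (nat \<Rightarrow> real) \<Rightarrow> real \<Rightarrow> (nat \<Rightarrow> real) \<Rightarrow> (nat \<Rightarrow> real) \<Rightarrow> nat \<Rightarrow> nat \<Rightarrow> real"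
where
  "Ntilde_entry M i b t k lam j l =
     (if j \<in> {2..M - 1} then
        (if l = j then 1 + t * lam j * (1 + ktilde i k j)
         else if l = j + 1 then - t * lam j * q_up i b j
         else if l = j - 1 then - t * lam j * q_down i b j
         else if l = M + 1 then - t * lam j * ktilde i k j
         else 0)
      else (if l = j then 1 else 0))"

text \<open>
  \<open>Ntilde_entry\<close> uses row and column indices \<open>1, \<dots>, M + 1\<close>, whereas matrices are indexed
  from \<open>0\<close>: the \<open>(j, l)\<close> entry of a matrix \<open>A\<close> is \<open>A $$ (j - 1, l - 1)\<close>.
\<close>

definition Ntilde ::
  "nat \<Rightarrow> (nat \<Rightarrow> real) \<Rightarrow> (nat \<Rightarrow> real) \<Rightarrow> real \<Rightarrow> (nat \<Rightarrow> real) \<Rightarrow> (nat \<Rightarrow> real) \<Rightarrow> real mat"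
where
  "Ntilde M i b t k lam =
     mat (M + 1) (M + 1) (\<lambda>(r, s). Ntilde_entry M i b t k lam (r + 1) (s + 1))"

end

theory Submission
  imports Defs "Jordan_Normal_Form.Determinant"
begin

text \<open>
  Off the diagonal the matrix \<open>N\<close> is nonpositive, and its rows sum to one, so a discrete minimum
  principle holds: \<open>N v \<ge> 0\<close> implies \<open>v \<ge> 0\<close>. In particular \<open>N\<close> is invertible. Choose
  \<open>\<delta> \<in> (0, 1]\<close> with \<open>\<delta> (1 + k\<^sub>j) \<le> q\<^sub>j\<^sub>,\<^sub>j\<^sub>-\<^sub>1\<close> for all \<open>j\<close> (here \<open>k\<^sub>j\<close> is the rescaled rate), and
  put \<open>\<phi>\<^sub>j = \<delta>\<^bsup>j-1\<^esup>\<close> for \<open>j \<le> M\<close> and \<open>\<phi>\<^sub>M\<^sub>+\<^sub>1 = 0\<close>. Then \<open>N \<phi> \<le> \<phi>\<close> whatever the \<open>\<lambda>\<^sub>j \<ge> 0\<close> are, so the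
  minimum principle propagates \<open>\<phi> \<le> 1 - N\<^bsup>-p\<^esup> e\<^sub>M\<^sub>+\<^sub>1\<close> from \<open>p\<close> to \<open>p + 1\<close>. The bound obtained
  is uniform in \<open>p\<close> as well.
\<close>

section \<open>Discrete minimum principle\<close>

definition Z_matrix_row_sum_one :: "nat \<Rightarrow> real mat \<Rightarrow> bool" where
  "Z_matrix_row_sum_one n A \<longleftrightarrow>
     A \<in> carrier_mat n n \<and>
     (\<forall>r<n. \<forall>s<n. r \<noteq> s \<longrightarrow> A $$ (r, s) \<le> 0) \<and>
     (\<forall>r<n. (\<Sum>s<n. A $$ (r, s)) = 1)"

text \<open>At an index \<open>m\<close> where \<open>v\<close> is minimal, replacing every
  \<open>v s\<close> by \<open>v m\<close> can only increase the row sum, since off-diagonal entries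
  are nonpositive. The unit row sum turns the result into \<open>v m\<close>.\<close>

lemma minimum_principle:
  assumes A: "Z_matrix_row_sum_one n A"
    and nonneg: "\<And>r. r < n \<Longrightarrow> (\<Sum>s<n. A $$ (r, s) * v s) \<ge> 0"
    and "r < n"
  shows "v r \<ge> 0"
proof -
  have "finite (v ` {..<n})" "v ` {..<n} \<noteq> {}" using \<open>r < n\<close> by auto
  from Min_in[OF this] obtain m where m: "m < n" "v m = Min (v ` {..<n})" by auto
  have m_le: "v m \<le> v s" if "s < n" for s
    using that m(2) by simp
  have "A $$ (m, s) * v s \<le> A $$ (m, s) * v m" if "s < n" for s
  proof (cases "s = m")
    case False
    then have "A $$ (m, s) \<le> 0"
      using A m(1) that unfolding Z_matrix_row_sum_one_def by auto
    then show ?thesis using m_le[OF that] by (rule mult_left_mono_neg[rotated])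
  qed simp
  then have "(\<Sum>s<n. A $$ (m, s) * v s) \<le> (\<Sum>s<n. A $$ (m, s) * v m)"
    by (intro sum_mono) simp
  also have "\<dots> = v m"
    using A m(1) unfolding Z_matrix_row_sum_one_def by (simp flip: sum_distrib_right)
  finally have "0 \<le> v m" using nonneg[OF m(1)] by simp
  then show ?thesis using m_le[OF \<open>r < n\<close>] by simp
qed

text \<open>For a kernel vector \<open>v\<close> the minimum principle applies to both
  \<open>v\<close> and \<open>- v\<close>.\<close>

lemma Z_matrix_det_nonzero:
  assumes A: "Z_matrix_row_sum_one n A"
  shows "det A \<noteq> 0"
proof
  have carrier: "A \<in> carrier_mat n n" using A unfolding Z_matrix_row_sum_one_def by simp
  assume "det A = 0"
  then obtain v where v: "v \<in> carrier_vec n" "v \<noteq> 0\<^sub>v n" "A *\<^sub>v v = 0\<^sub>v n"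
    using det_0_iff_vec_prod_zero[OF carrier] by auto
  have row: "(\<Sum>s<n. A $$ (r, s) * v $ s) = 0" if "r < n" for r
  proof -
    have "(A *\<^sub>v v) $ r = (\<Sum>s<n. A $$ (r, s) * v $ s)"
      using carrier v(1) that by (simp add: scalar_prod_def atLeast0LessThan)
    then show ?thesis using v(3) that by simp
  qed
  have "v $ r = 0" if "r < n" for r
    using minimum_principle[OF A, of "\<lambda>s. v $ s" r] minimum_principle[OF A, of "\<lambda>s. - v $ s" r]
      row that by (simp add: sum_negf)
  then have "v = 0\<^sub>v n" using v(1) by auto
  with v(2) show False by simp
qed

section \<open>Inverses and their powers\<close>

lemma mat_inverse_of_det_nonzero:
  fixes A :: "'a :: field mat"
  assumes A: "A \<in> carrier_mat n n" and "det A \<noteq> 0"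
  shows "A * the (mat_inverse A) = 1\<^sub>m n" "the (mat_inverse A) * A = 1\<^sub>m n"
    "the (mat_inverse A) \<in> carrier_mat n n"
proof -
  have "mat_inverse A \<noteq> None"
    using mat_inverse(1)[OF A] det_non_zero_imp_unit[OF assms] by metis
  then obtain B where "mat_inverse A = Some B" by auto
  with mat_inverse(2)[OF A this]
  show "A * the (mat_inverse A) = 1\<^sub>m n" "the (mat_inverse A) * A = 1\<^sub>m n"
    "the (mat_inverse A) \<in> carrier_mat n n" by auto
qed

text \<open>Powers unfold on the right; a factor split off on the left is what cancels against
  \<open>A\<close> in \<open>A * P ^\<^sub>m Suc p\<close>.\<close>

lemma pow_mat_Suc_left:
  fixes A :: "'a :: semiring_1 mat"
  assumes A: "A \<in> carrier_mat n n"
  shows "A ^\<^sub>m Suc p = A * A ^\<^sub>m p"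
proof (induction p)
  case 0
  then show ?case using A by simp
next
  case (Suc p)
  have "A ^\<^sub>m Suc (Suc p) = A * A ^\<^sub>m p * A" using Suc by simp
  also have "\<dots> = A * (A ^\<^sub>m p * A)" using A pow_carrier_mat[OF A] by (intro assoc_mult_mat) auto
  finally show ?case by simp
qed

lemma inverse_pow_column_le:
  assumes A: "Z_matrix_row_sum_one n A"
    and P: "A * P = 1\<^sub>m n" "P \<in> carrier_mat n n"
    and sub: "\<And>r. r < n \<Longrightarrow> (\<Sum>s<n. A $$ (r, s) * \<phi> s) \<le> \<phi> r"
    and le_one: "\<And>r. r < n \<Longrightarrow> \<phi> r \<le> 1"
    and m: "m < n" "\<phi> m \<le> 0"
    and "r < n"
  shows "(P ^\<^sub>m p) $$ (r, m) \<le> 1 - \<phi> r"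
  using \<open>r < n\<close>
proof (induction p arbitrary: r)
  case 0
  \<comment> \<open>Column \<open>m\<close> of the identity is a unit vector:
    \<open>\<phi> m \<le> 0\<close> settles row \<open>m\<close>, and \<open>\<phi> \<le> 1\<close>
    the others.\<close>
  then show ?case using P(2) m le_one by (auto simp: one_mat_def)
next
  case (Suc p)
  have carrier: "A \<in> carrier_mat n n" and row_sum: "\<And>r. r < n \<Longrightarrow> (\<Sum>s<n. A $$ (r, s)) = 1"
    using A unfolding Z_matrix_row_sum_one_def by auto
  have pow: "P ^\<^sub>m k \<in> carrier_mat n n" for k using P(2) by (rule pow_carrier_mat)
  have "A * P ^\<^sub>m Suc p = A * P * P ^\<^sub>m p"
    unfolding pow_mat_Suc_left[OF P(2)] using carrier P(2) pow by (intro assoc_mult_mat[symmetric]) auto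
  then have prod: "A * P ^\<^sub>m Suc p = P ^\<^sub>m p" unfolding P(1) using left_mult_one_mat[OF pow] by simp
  have apply_A: "(\<Sum>s<n. A $$ (q, s) * (P ^\<^sub>m Suc p) $$ (s, m)) = (P ^\<^sub>m p) $$ (q, m)" if "q < n" for q
  proof -
    have "(A * P ^\<^sub>m Suc p) $$ (q, m) = (\<Sum>s<n. A $$ (q, s) * (P ^\<^sub>m Suc p) $$ (s, m))"
      using carrier that m(1) carrier_matD[OF pow[of "Suc p"]]
      by (auto simp: scalar_prod_def atLeast0LessThan simp del: pow_mat.simps)
    then show ?thesis unfolding prod by simp
  qed
  have "0 \<le> 1 - (P ^\<^sub>m Suc p) $$ (r, m) - \<phi> r"
  proof (rule minimum_principle[OF A _ Suc.prems])
    fix q assume q: "q < n"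
    \<comment> \<open>\<open>A\<close> fixes the constant 1 and lowers the power of \<open>P\<close>
      by one, so the induction hypothesis meets the subsolution property of
      \<open>\<phi>\<close>.\<close>
    have "(\<Sum>s<n. A $$ (q, s) * (1 - (P ^\<^sub>m Suc p) $$ (s, m) - \<phi> s))
        = 1 - (P ^\<^sub>m p) $$ (q, m) - (\<Sum>s<n. A $$ (q, s) * \<phi> s)"
      using row_sum[OF q] apply_A[OF q]
      by (simp add: right_diff_distrib sum_subtractf del: pow_mat.simps)
    then show "0 \<le> (\<Sum>s<n. A $$ (q, s) * (1 - (P ^\<^sub>m Suc p) $$ (s, m) - \<phi> s))"
      using Suc.IH[OF q] sub[OF q] by linarith
  qed
  then show ?case by linarith
qed

section \<open>Action of the matrix on a function\<close>

lemma Ntilde_entry_sum: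
  assumes "j \<in> {1..M + 1}"
  shows "(\<Sum>l\<in>{1..M + 1}. Ntilde_entry M i b t k lam j l * f l) =
    (if j \<in> {2..M - 1} then
       f j + t * lam j * ((1 + ktilde i k j) * f j - q_up i b j * f (j + 1)
         - q_down i b j * f (j - 1) - ktilde i k j * f (M + 1))
     else f j)"
proof (cases "j \<in> {2..M - 1}")
  case True
  \<comment> \<open>As \<open>2 \<le> j\<close> and \<open>j + 1 \<le> M\<close>, the columns
    \<open>j\<close>, \<open>j + 1\<close>, \<open>j - 1\<close>, \<open>M + 1\<close> are pairwise
    distinct, so the nested conditional splits into four one-point terms.\<close>
  have "(\<Sum>l\<in>{1..M + 1}. Ntilde_entry M i b t k lam j l * f l) =
     (\<Sum>l\<in>{1..M + 1}.
        (if l = j then (1 + t * lam j * (1 + ktilde i k j)) * f l else 0)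
      + (if l = j + 1 then - t * lam j * q_up i b j * f l else 0)
      + (if l = j - 1 then - t * lam j * q_down i b j * f l else 0)
      + (if l = M + 1 then - t * lam j * ktilde i k j * f l else 0))"
    using True by (intro sum.cong) (auto simp: Ntilde_entry_def)
  also have "\<dots> = (1 + t * lam j * (1 + ktilde i k j)) * f j - t * lam j * q_up i b j * f (j + 1)
      - t * lam j * q_down i b j * f (j - 1) - t * lam j * ktilde i k j * f (M + 1)"
  proof -
    have "j \<in> {1..M + 1}" "j + 1 \<in> {1..M + 1}" "j - 1 \<in> {1..M + 1}" "M + 1 \<in> {1..M + 1}"
      using True by auto
    then show ?thesis by (simp only: sum.distrib sum.delta finite_atLeastAtMost if_True)
  qed
  also have "\<dots> = f j + t * lam j * ((1 + ktilde i k j) * f j - q_up i b j * f (j + 1)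
         - q_down i b j * f (j - 1) - ktilde i k j * f (M + 1))"
    by (simp add: algebra_simps)
  finally show ?thesis using True by (simp only: if_True)
next
  case False
  have "(\<Sum>l\<in>{1..M + 1}. Ntilde_entry M i b t k lam j l * f l) =
     (\<Sum>l\<in>{1..M + 1}. if l = j then f l else 0)"
    using False by (intro sum.cong) (auto simp: Ntilde_entry_def)
  also have "\<dots> = f j" using assms by (simp only: sum.delta finite_atLeastAtMost if_True)
  finally show ?thesis using False by (simp only: if_False)
qed

lemma Ntilde_row_sum:
  assumes "r < M + 1"
  shows "(\<Sum>s<M + 1. Ntilde M i b t k lam $$ (r, s) * f (s + 1)) =
    (\<Sum>l\<in>{1..M + 1}. Ntilde_entry M i b t k lam (r + 1) l * f l)"
proof -
  have "(\<Sum>s<M + 1. Ntilde M i b t k lam $$ (r, s) * f (s + 1)) =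
    (\<Sum>s<M + 1. Ntilde_entry M i b t k lam (r + 1) (Suc s) * f (Suc s))"
    using assms by (intro sum.cong) (auto simp: Ntilde_def)
  also have "\<dots> = (\<Sum>l\<in>{1..M + 1}. Ntilde_entry M i b t k lam (r + 1) l * f l)"
    by (rule sum.reindex_bij_witness[of _ "\<lambda>l. l - 1" Suc]) auto
  finally show ?thesis .
qed

section \<open>Consequences of the grid and drift conditions\<close>

context
  fixes M :: nat and i b k :: "nat \<Rightarrow> real"
  assumes mono: "strict_mono_on {1..M} i"
    and b_bounds: "\<And>j. j \<in> {2..M - 1} \<Longrightarrow>
           - (1 / (i (j + 1) - i j)) < b j \<and> b j < 1 / (i j - i (j - 1))"
    and k_nonneg: "\<And>j. j \<in> {2..M - 1} \<Longrightarrow> k j \<ge> 0"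
begin

lemma grid_gaps_pos:
  assumes "j \<in> {2..M - 1}"
  shows "i (j + 1) - i j > 0" "i j - i (j - 1) > 0"
proof -
  have "j \<in> {1..M}" "j + 1 \<in> {1..M}" "j - 1 \<in> {1..M}" "j - 1 < j" using assms by auto
  then show "i (j + 1) - i j > 0" "i j - i (j - 1) > 0"
    using strict_mono_onD[OF mono, of j "j + 1"] strict_mono_onD[OF mono, of "j - 1" j] by auto
qed

text \<open>The lower bound on \<open>b j\<close> amounts to positivity of the second factor; the
  upper bound does the same for \<open>q_down\<close>.\<close>

lemma q_up_pos:
  assumes "j \<in> {2..M - 1}"
  shows "q_up i b j > 0"
proof -
  have "1 + (i (j + 1) - i j) * b j > 0"
    using b_bounds[OF assms] grid_gaps_pos[OF assms] by (auto simp: field_simps)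
  then show ?thesis unfolding q_up_def using grid_gaps_pos[OF assms] by simp
qed

lemma q_down_pos:
  assumes "j \<in> {2..M - 1}"
  shows "q_down i b j > 0"
proof -
  have "1 - (i j - i (j - 1)) * b j > 0"
    using b_bounds[OF assms] grid_gaps_pos[OF assms] by (auto simp: field_simps)
  then show ?thesis unfolding q_down_def using grid_gaps_pos[OF assms] by simp
qed

lemma q_up_plus_q_down:
  assumes "j \<in> {2..M - 1}"
  shows "q_up i b j + q_down i b j = 1"
proof -
  \<comment> \<open>Here \<open>x\<close> and \<open>y\<close> are the left and right gaps; the
    terms in \<open>\<beta>\<close> cancel.\<close>
  have eq: "x / (x + y) * (1 + y * \<beta>) + y / (x + y) * (1 - x * \<beta>) = 1"
    if "x > 0" "y > 0" for x y \<beta> :: real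
  proof -
    have "x / (x + y) * (1 + y * \<beta>) + y / (x + y) * (1 - x * \<beta>)
        = (x * (1 + y * \<beta>) + y * (1 - x * \<beta>)) / (x + y)" by (simp add: add_divide_distrib)
    also have "x * (1 + y * \<beta>) + y * (1 - x * \<beta>) = x + y" by (simp add: algebra_simps)
    finally show ?thesis using that by simp
  qed
  show ?thesis
    using eq[OF grid_gaps_pos(2,1)[OF assms], of "b j"] unfolding q_up_def q_down_def by simp
qed

lemma ktilde_nonneg:
  assumes "j \<in> {2..M - 1}"
  shows "ktilde i k j \<ge> 0"
  using grid_gaps_pos[OF assms] k_nonneg[OF assms] unfolding ktilde_def by simp

lemma Ntilde_Z_matrix:
  assumes "t > 0" and lam: "\<And>j. j \<in> {2..M - 1} \<Longrightarrow> lam j \<ge> 0"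
  shows "Z_matrix_row_sum_one (M + 1) (Ntilde M i b t k lam)"
  unfolding Z_matrix_row_sum_one_def
proof (intro conjI allI impI)
  show "Ntilde M i b t k lam \<in> carrier_mat (M + 1) (M + 1)" by (simp add: Ntilde_def)
next
  fix r s assume rs: "r < M + 1" "s < M + 1" "r \<noteq> s"
  have "t * lam (Suc r) * q_up i b (Suc r) \<ge> 0" "t * lam (Suc r) * q_down i b (Suc r) \<ge> 0"
    "t * lam (Suc r) * ktilde i k (Suc r) \<ge> 0" if "Suc r \<in> {2..M - 1}"
    using q_up_pos[OF that] q_down_pos[OF that] ktilde_nonneg[OF that] lam[OF that] \<open>t > 0\<close>
    by simp_all
  then show "Ntilde M i b t k lam $$ (r, s) \<le> 0"
    using rs by (simp add: Ntilde_def Ntilde_entry_def)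
next
  fix r assume r: "r < M + 1"
  \<comment> \<open>Row sums are the action on the constant 1, for which the bracket in
    \<open>Ntilde_entry_sum\<close> vanishes by \<open>q_up_plus_q_down\<close>.\<close>
  have "(\<Sum>s<M + 1. Ntilde M i b t k lam $$ (r, s)) =
      (\<Sum>l\<in>{1..M + 1}. Ntilde_entry M i b t k lam (r + 1) l)"
    using Ntilde_row_sum[OF r, of i b t k lam "\<lambda>_. 1"] by simp
  also have "\<dots> = 1"
    using Ntilde_entry_sum[of "r + 1" M i b t k lam "\<lambda>_. 1"] r q_up_plus_q_down[of "r + 1"]
    by (auto split: if_splits)
  finally show "(\<Sum>s<M + 1. Ntilde M i b t k lam $$ (r, s)) = 1" .
qed

lemma exists_decay_rate:
  "\<exists>\<delta>>0. \<delta> \<le> 1 \<and> (\<forall>j\<in>{2..M - 1}. \<delta> * (1 + ktilde i k j) \<le> q_down i b j)"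
proof -
  \<comment> \<open>Finitely many positive ratios have a positive minimum; inserting 1 keeps the set
    nonempty and yields \<delta> \<le> 1.\<close>
  define S where "S = insert 1 ((\<lambda>j. q_down i b j / (1 + ktilde i k j)) ` {2..M - 1})"
  have S: "finite S" "S \<noteq> {}" unfolding S_def by auto
  have denom: "1 + ktilde i k j > 0" if "j \<in> {2..M - 1}" for j using ktilde_nonneg[OF that] by simp
  have "Min S > 0"
    using S q_down_pos denom unfolding S_def by (subst Min_gr_iff) auto
  moreover have "Min S \<le> 1" using S(1) by (intro Min_le) (auto simp: S_def)
  moreover have "Min S * (1 + ktilde i k j) \<le> q_down i b j" if "j \<in> {2..M - 1}" for j
  proof -
    have "Min S \<le> q_down i b j / (1 + ktilde i k j)"
      using S(1) that by (intro Min_le) (auto simp: S_def)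
    then show ?thesis using denom[OF that] by (simp add: pos_le_divide_eq)
  qed
  ultimately show ?thesis by blast
qed

text \<open>In an interior row the factor multiplying \<open>t * lam j\<close> is nonpositive, so
  the size of \<open>lam j\<close> does not matter; the other rows give equality.\<close>

lemma Ntilde_subsolution:
  assumes "t > 0" and lam: "\<And>j. j \<in> {2..M - 1} \<Longrightarrow> lam j \<ge> 0"
    and \<delta>: "\<delta> > 0" "\<And>j. j \<in> {2..M - 1} \<Longrightarrow> \<delta> * (1 + ktilde i k j) \<le> q_down i b j"
    and r: "r < M + 1"
  defines "\<phi> \<equiv> \<lambda>l. if l \<le> M then \<delta> ^ (l - 1) else 0"
  shows "(\<Sum>s<M + 1. Ntilde M i b t k lam $$ (r, s) * \<phi> (s + 1)) \<le> \<phi> (r + 1)"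
proof -
  define j where "j = r + 1"
  have eq: "(\<Sum>s<M + 1. Ntilde M i b t k lam $$ (r, s) * \<phi> (s + 1)) =
    (if j \<in> {2..M - 1} then
       \<phi> j + t * lam j * ((1 + ktilde i k j) * \<phi> j - q_up i b j * \<phi> (j + 1)
         - q_down i b j * \<phi> (j - 1) - ktilde i k j * \<phi> (M + 1))
     else \<phi> j)"
    unfolding Ntilde_row_sum[OF r] j_def by (rule Ntilde_entry_sum) (use r in auto)
  show ?thesis
  proof (cases "j \<in> {2..M - 1}")
    case True
    \<comment> \<open>Since \<open>j \<ge> 2\<close>, the subtractions on \<open>nat\<close> are
      exact and one factor \<delta> separates the two values.\<close>
    have "\<phi> j = \<delta> * \<delta> ^ (j - 2)" "\<phi> (j - 1) = \<delta> ^ (j - 2)"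
      using True by (auto simp: \<phi>_def numeral_2_eq_2 simp flip: power_Suc intro!: arg_cong[of _ _ "power \<delta>"])
    then have "(1 + ktilde i k j) * \<phi> j \<le> q_down i b j * \<phi> (j - 1)"
      using mult_right_mono[OF \<delta>(2)[OF True], of "\<delta> ^ (j - 2)"] \<delta>(1) by (simp add: ac_simps)
    moreover have "q_up i b j * \<phi> (j + 1) \<ge> 0"
      using q_up_pos[OF True] \<delta>(1) by (simp add: \<phi>_def)
    moreover have "\<phi> (M + 1) = 0" by (simp add: \<phi>_def)
    ultimately have "(1 + ktilde i k j) * \<phi> j - q_up i b j * \<phi> (j + 1)
         - q_down i b j * \<phi> (j - 1) - ktilde i k j * \<phi> (M + 1) \<le> 0" by simp
    then show ?thesis
      unfolding eq using True lam[OF True] \<open>t > 0\<close>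
      by (simp only: if_True flip: j_def) (simp add: mult_nonneg_nonpos)
  next
    case False
    then show ?thesis unfolding eq by (simp only: if_False order_refl flip: j_def)
  qed
qed

end

section \<open>The uniform bound\<close>

theorem lemma7p2:
  fixes M p :: nat and t :: real and i b k :: "nat \<Rightarrow> real"
  assumes "M \<ge> 3"
    and "t > 0"
    and "strict_mono_on {1..M} i"
    and "\<And>j. j \<in> {2..M - 1} \<Longrightarrow>
           - (1 / (i (j + 1) - i j)) < b j \<and> b j < 1 / (i j - i (j - 1))"
    and "\<And>j. j \<in> {2..M - 1} \<Longrightarrow> k j \<ge> 0"
    and "p \<ge> 1"
  shows "\<exists>c>0. \<forall>lam :: nat \<Rightarrow> real. (\<forall>j\<in>{2..M - 1}. lam j \<ge> 0) \<longrightarrow>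
           invertible_mat (Ntilde M i b t k lam) \<and>
           (\<forall>j\<in>{1..M}.
              (the (mat_inverse (Ntilde M i b t k lam)) ^\<^sub>m p) $$ (j - 1, (M + 1) - 1) < 1 - c)"
proof -
  obtain \<delta> where \<delta>: "\<delta> > 0" "\<delta> \<le> 1"
    "\<And>j. j \<in> {2..M - 1} \<Longrightarrow> \<delta> * (1 + ktilde i k j) \<le> q_down i b j"
    using exists_decay_rate[where k = k, OF assms(3,4,5)] by auto
  define \<phi> where "\<phi> = (\<lambda>l. if l \<le> M then \<delta> ^ (l - 1) else 0)"
  show ?thesis
  \<comment> \<open>As \<delta> \<le> 1, \<open>\<phi> \<ge> \<delta> ^ M\<close> on 1, ...,
    \<open>M\<close>; halving makes the inequality strict. \<delta> was fixed before
    \<open>lam\<close>.\<close>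
  proof (intro exI[of _ "\<delta> ^ M / 2"] conjI allI impI ballI)
    show "\<delta> ^ M / 2 > 0" using \<delta>(1) by simp
  next
    fix lam :: "nat \<Rightarrow> real" assume lam: "\<forall>j\<in>{2..M - 1}. lam j \<ge> 0"
    let ?N = "Ntilde M i b t k lam"
    let ?P = "the (mat_inverse ?N)"
    have Z: "Z_matrix_row_sum_one (M + 1) ?N"
      by (rule Ntilde_Z_matrix[where k = k, OF assms(3,4,5,2)]) (use lam in auto)
    then have N: "?N \<in> carrier_mat (M + 1) (M + 1)" unfolding Z_matrix_row_sum_one_def by simp
    note P = mat_inverse_of_det_nonzero[OF N Z_matrix_det_nonzero[OF Z]]
    show "invertible_mat ?N"
      unfolding invertible_mat_def inverts_mat_def using N P by (auto intro!: exI[of _ ?P])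
    fix j assume j: "j \<in> {1..M}"
    \<comment> \<open>Column \<open>M\<close> counted from 0 is column \<open>M + 1\<close>, where
      \<open>\<phi>\<close> vanishes; \<open>j - 1 + 1\<close> matches the shifted
      \<open>\<phi>\<close> passed to the rule.\<close>
    have "(?P ^\<^sub>m p) $$ (j - 1, M) \<le> 1 - \<phi> (j - 1 + 1)"
    proof (rule inverse_pow_column_le[OF Z P(1,3), where \<phi> = "\<lambda>r. \<phi> (r + 1)"])
      show "(\<Sum>s<M + 1. ?N $$ (r, s) * \<phi> (s + 1)) \<le> \<phi> (r + 1)" if "r < M + 1" for r
        unfolding \<phi>_def
        by (rule Ntilde_subsolution[where k = k, OF assms(3,4,5,2)]) (use lam \<delta> that in auto)
      show "\<phi> (r + 1) \<le> 1" for r using \<delta> by (simp add: \<phi>_def power_le_one)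
    qed (use j in \<open>auto simp: \<phi>_def\<close>)
    moreover have "\<phi> (j - 1 + 1) \<ge> \<delta> ^ M"
      using power_decreasing[of "j - 1" M \<delta>] j \<delta>(1,2) by (auto simp: \<phi>_def)
    moreover have "\<delta> ^ M > 0" using \<delta>(1) by simp
    ultimately show "(?P ^\<^sub>m p) $$ (j - 1, (M + 1) - 1) < 1 - \<delta> ^ M / 2" by simp
  qed
qed

end
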